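(* Let $n\ge 1$. For pairwise distinct points $x_0,\dots,x_n\in\mathbb{H}$ consider either of the following choices of functions $\ell_0,\dots,\ell_n:\mathbb{H}\to\mathbb{H}$, where all products over $k$ are multiplied out in the order of increasing index $k$: (A) $\displaystyle \ell_j(x)=\prod_{k\ne j}(x-x_k)(x_j-x_k)^{-1}$; (B) $\displaystyle \ell_j(x)=\Bigl(\prod_{k\ne j}(x-x_k)\Bigr)\Bigl(\prod_{k\ne j}(x_j-x_k)\Bigr)^{-1}$. Then for either choice the following hold. 1. For every choice of pairwise distinct points $x_0,\dots,x_n\in\mathbb{H}$, the right $\mathbb{H}$-span of $\{\ell_0,\dots,\ell_n\}$ is an $(n+1)$-dimensional subspace of $\mathrm{Pol}_n(\mathbb{H})$. Moreover, for every $f:\mathbb{H}\to\mathbb{H}$ there is a unique $p$ in this span with $p(x_j)=f(x_j)$ for $0\le j\le n$, and the resulting operator $f\mapsto p=\sum_j\ell_j f(x_j)$ is right $\mathbb{H}$-linear. 2. Each $\ell_j$ has precisely $n$ zeros in $\mathbb{H}$, namely the points $x_k$ with $k\ne j$. 3. The interpolation operator depends continuously on the interpolation points, i.e., for each $j$ the polynomial $\ell_j\in\mathrm{Pol}_n(\mathbb{H})$ is a continuous function of $(x_0,\dots,x_n)$ on the set of $(n+1)$-tuples of pairwise distinct points of $\mathbb{H}$.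
   Context: $\mathbb{H}$ denotes the real quaternions. Spaces of functions $\mathbb{H}\to\mathbb{H}$ are regarded as right $\mathbb{H}$-vector spaces (right $\mathbb{H}$-modules), with $(f\alpha)(x)=f(x)\alpha$ for $\alpha\in\mathbb{H}$. A quaternionic monomial of degree $r$ is a function $\mathbb{H}\to\mathbb{H}$ of the form $q\mapsto \alpha_0 q\alpha_1 q\alpha_2\cdots q\alpha_{r-1}q\alpha_r$ with $\alpha_0,\dots,\alpha_r\in\mathbb{H}$. $\mathrm{Hom}_r(\mathbb{H})$ is the $\mathbb{H}$-span of the monomials of degree $r$. $\mathrm{Pol}_n(\mathbb{H})$ (polynomials of degree $n$) is the $\mathbb{H}$-span of all $\mathrm{Hom}_r(\mathbb{H})$ with $r\le n$. It is finite dimensional and carries its usual topology as a finite-dimensional real vector space. *)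

theory Defs
  imports "HOL-Analysis.Analysis" "HOL-Library.Function_Algebras"
begin

section \<open>The real quaternions\<close>

codatatype quat = Quat (QRe: real) (QIm1: real) (QIm2: real) (QIm3: real)

lemma quat_eq_iff:
  "x = y \<longleftrightarrow> QRe x = QRe y \<and> QIm1 x = QIm1 y \<and> QIm2 x = QIm2 y \<and> QIm3 x = QIm3 y"
  using quat.expand by blast

instantiation quat :: ab_group_add
begin

primcorec zero_quat where
  "QRe 0 = 0"
| "QIm1 0 = 0"
| "QIm2 0 = 0"
| "QIm3 0 = 0"

primcorec plus_quat where
  "QRe (x + y) = QRe x + QRe y"
| "QIm1 (x + y) = QIm1 x + QIm1 y"
| "QIm2 (x + y) = QIm2 x + QIm2 y"
| "QIm3 (x + y) = QIm3 x + QIm3 y"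

primcorec uminus_quat where
  "QRe (- x) = - QRe x"
| "QIm1 (- x) = - QIm1 x"
| "QIm2 (- x) = - QIm2 x"
| "QIm3 (- x) = - QIm3 x"

primcorec minus_quat where
  "QRe (x - y) = QRe x - QRe y"
| "QIm1 (x - y) = QIm1 x - QIm1 y"
| "QIm2 (x - y) = QIm2 x - QIm2 y"
| "QIm3 (x - y) = QIm3 x - QIm3 y"

instance
  by standard (simp_all add: quat_eq_iff)

end

instantiation quat :: ring_1
begin

primcorec one_quat where
  "QRe 1 = 1"
| "QIm1 1 = 0"
| "QIm2 1 = 0"
| "QIm3 1 = 0"

primcorec times_quat where
  "QRe (x * y) = QRe x * QRe y - QIm1 x * QIm1 y - QIm2 x * QIm2 y - QIm3 x * QIm3 y"
| "QIm1 (x * y) = QRe x * QIm1 y + QIm1 x * QRe y + QIm2 x * QIm3 y - QIm3 x * QIm2 y"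
| "QIm2 (x * y) = QRe x * QIm2 y - QIm1 x * QIm3 y + QIm2 x * QRe y + QIm3 x * QIm1 y"
| "QIm3 (x * y) = QRe x * QIm3 y + QIm1 x * QIm2 y - QIm2 x * QIm1 y + QIm3 x * QRe y"

instance
  by standard (simp_all add: quat_eq_iff algebra_simps)

end

instantiation quat :: real_algebra_1
begin

primcorec scaleR_quat where
  "QRe (r *\<^sub>R x) = r * QRe x"
| "QIm1 (r *\<^sub>R x) = r * QIm1 x"
| "QIm2 (r *\<^sub>R x) = r * QIm2 x"
| "QIm3 (r *\<^sub>R x) = r * QIm3 x"

instance
  by standard (simp_all add: quat_eq_iff algebra_simps)

end

instantiation quat :: real_inner
begin

definition inner_quat :: "quat \<Rightarrow> quat \<Rightarrow> real" where
  "inner_quat x y = QRe x * QRe y + QIm1 x * QIm1 y + QIm2 x * QIm2 y + QIm3 x * QIm3 y"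

definition norm_quat :: "quat \<Rightarrow> real" where
  "norm_quat x = sqrt (x \<bullet> x)"

definition sgn_quat :: "quat \<Rightarrow> quat" where
  "sgn_quat x = x /\<^sub>R norm x"

definition dist_quat :: "quat \<Rightarrow> quat \<Rightarrow> real" where
  "dist_quat x y = norm (x - y)"

definition uniformity_quat :: "(quat \<times> quat) filter" where
  "uniformity_quat = (INF e\<in>{0 <..}. principal {(x, y). dist x y < e})"

definition open_quat :: "quat set \<Rightarrow> bool" where
  "open_quat U \<longleftrightarrow> (\<forall>x\<in>U. eventually (\<lambda>(x', y). x' = x \<longrightarrow> y \<in> U) uniformity)"

instance
proof
  fix x y z :: quat and r :: real and U :: "quat set"
  show "x \<bullet> y = y \<bullet> x" "(x + y) \<bullet> z = x \<bullet> z + y \<bullet> z" "(r *\<^sub>R x) \<bullet> y = r * (x \<bullet> y)"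
    by (simp_all add: inner_quat_def algebra_simps)
  show "0 \<le> x \<bullet> x"
    by (simp add: inner_quat_def)
  show "x \<bullet> x = 0 \<longleftrightarrow> x = 0"
    by (simp add: inner_quat_def quat_eq_iff add_nonneg_eq_0_iff)
qed (simp_all only: norm_quat_def sgn_quat_def dist_quat_def uniformity_quat_def open_quat_def)

end

lemma norm_quat_mult: "norm (x * y) = norm x * norm (y::quat)"
  by (simp add: norm_quat_def inner_quat_def real_sqrt_mult [symmetric] algebra_simps)

instantiation quat :: real_normed_div_algebra
begin

primcorec inverse_quat where
  "QRe (inverse x) = QRe x / (x \<bullet> x)"
| "QIm1 (inverse x) = - QIm1 x / (x \<bullet> x)"
| "QIm2 (inverse x) = - QIm2 x / (x \<bullet> x)"
| "QIm3 (inverse x) = - QIm3 x / (x \<bullet> x)"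

definition divide_quat where
  "x div y = x * inverse y" for x y :: quat

instance
proof
  fix x y :: quat
  show "inverse x * x = 1" "x * inverse x = 1" if "x \<noteq> 0"
  proof -
    define d where "d = x \<bullet> x"
    have "d \<noteq> 0" "QRe x * QRe x + QIm1 x * QIm1 x + QIm2 x * QIm2 x + QIm3 x * QIm3 x = d"
      using that by (simp_all add: d_def inner_quat_def [symmetric])
    then show "inverse x * x = 1" "x * inverse x = 1"
      by (simp_all add: quat_eq_iff d_def [symmetric] divide_simps)
  qed
  show "x div y = x * inverse y"
    by (simp add: divide_quat_def)
  show "inverse (0::quat) = 0"
    by (simp add: quat_eq_iff)
  show "norm (x * y) = norm x * norm y"
    by (rule norm_quat_mult)
qed

end


section \<open>Right linear algebra over the quaternions in spaces of functions\<close>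

text \<open>
  The modules and vector spaces of the libraries have commutative scalars,
  so the right-module notions over the quaternions are defined here.
\<close>

definition rscale :: "('a \<Rightarrow> quat) \<Rightarrow> quat \<Rightarrow> ('a \<Rightarrow> quat)" where
  "rscale f \<alpha> = (\<lambda>x. f x * \<alpha>)"

definition rspan :: "('a \<Rightarrow> quat) set \<Rightarrow> ('a \<Rightarrow> quat) set" where
  "rspan S = {\<Sum>g\<in>T. rscale g (c g) | T c. finite T \<and> T \<subseteq> S}"

definition rsubspace :: "('a \<Rightarrow> quat) set \<Rightarrow> bool" where
  "rsubspace V \<longleftrightarrow> 0 \<in> V \<and> (\<forall>f\<in>V. \<forall>g\<in>V. f + g \<in> V) \<and> (\<forall>f\<in>V. \<forall>\<alpha>. rscale f \<alpha> \<in> V)"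

definition rindependent :: "('a \<Rightarrow> quat) set \<Rightarrow> bool" where
  "rindependent B \<longleftrightarrow>
    (\<forall>T c. finite T \<longrightarrow> T \<subseteq> B \<longrightarrow> (\<Sum>g\<in>T. rscale g (c g)) = 0 \<longrightarrow> (\<forall>g\<in>T. c g = 0))"

definition has_rdim :: "('a \<Rightarrow> quat) set \<Rightarrow> nat \<Rightarrow> bool" where
  "has_rdim V d \<longleftrightarrow> (\<exists>B. finite B \<and> card B = d \<and> rindependent B \<and> rspan B = V)"

definition rlinear :: "(('a \<Rightarrow> quat) \<Rightarrow> ('b \<Rightarrow> quat)) \<Rightarrow> bool" where
  "rlinear L \<longleftrightarrow> (\<forall>f g. L (f + g) = L f + L g) \<and> (\<forall>f \<alpha>. L (rscale f \<alpha>) = rscale (L f) \<alpha>)"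


section \<open>Quaternionic polynomials\<close>

definition qmonomial :: "nat \<Rightarrow> (nat \<Rightarrow> quat) \<Rightarrow> quat \<Rightarrow> quat" where
  "qmonomial r \<alpha> q = \<alpha> 0 * (\<Prod>i\<leftarrow>[1..<Suc r]. q * \<alpha> i)"

definition QHom :: "nat \<Rightarrow> (quat \<Rightarrow> quat) set" where
  "QHom r = rspan (range (qmonomial r))"

definition QPol :: "nat \<Rightarrow> (quat \<Rightarrow> quat) set" where
  "QPol n = rspan (\<Union>r\<le>n. QHom r)"


section \<open>The topology of a finite-dimensional real vector space\<close>

instantiation "fun" :: (type, real_vector) real_vector
begin

definition scaleR_fun :: "real \<Rightarrow> ('a \<Rightarrow> 'b) \<Rightarrow> ('a \<Rightarrow> 'b)" where
  "scaleR_fun r f = (\<lambda>x. r *\<^sub>R f x)"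

instance
  by standard (simp_all add: scaleR_fun_def fun_eq_iff algebra_simps)

end

text \<open>
  A set is open if its image in \<open>\<real>\<^sup>B\<close> under the coordinates with respect to each finite basis \<open>B\<close>
  is open.  By \<open>homeomorphic_map_coordinates\<close> below, the choice of the basis does not matter.
\<close>

definition fin_dim_topology :: "'a::real_vector set \<Rightarrow> 'a topology" where
  "fin_dim_topology V = topology (\<lambda>U. U \<subseteq> V \<and>
     (\<forall>B. finite B \<and> independent B \<and> span B = V \<longrightarrow>
        openin (product_topology (\<lambda>_. euclideanreal) B)
          {c \<in> B \<rightarrow>\<^sub>E UNIV. (\<Sum>b\<in>B. c b *\<^sub>R b) \<in> U}))"

lemma openin_fin_dim_topology:
  "openin (fin_dim_topology V) U \<longleftrightarrow> U \<subseteq> V \<and>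
     (\<forall>B. finite B \<and> independent B \<and> span B = V \<longrightarrow>
        openin (product_topology (\<lambda>_. euclideanreal) B)
          {c \<in> B \<rightarrow>\<^sub>E UNIV. (\<Sum>b\<in>B. c b *\<^sub>R b) \<in> U})"
proof -
  define O' where "O' B U = {c \<in> B \<rightarrow>\<^sub>E (UNIV::real set). (\<Sum>b\<in>B. c b *\<^sub>R b) \<in> U}"
    for B U :: "'a set"
  have *: "O' B (S \<inter> T) = O' B S \<inter> O' B T" "O' B (\<Union>\<K>) = (\<Union>S\<in>\<K>. O' B S)" for B S T \<K>
    by (auto simp: O'_def)
  have "istopology (\<lambda>U. U \<subseteq> V \<and> (\<forall>B. finite B \<and> independent B \<and> span B = V \<longrightarrow>
          openin (product_topology (\<lambda>_. euclideanreal) B) (O' B U)))"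
    unfolding istopology_def * by (auto intro!: openin_Int openin_Union)
  then show ?thesis
    unfolding fin_dim_topology_def O'_def [symmetric] by (simp add: topology_inverse')
qed

lemma topspace_fin_dim_topology [simp]: "topspace (fin_dim_topology V) = V"
proof -
  have "openin (fin_dim_topology V) V"
  proof -
    have "openin (product_topology (\<lambda>_. euclideanreal) B)
            {c \<in> B \<rightarrow>\<^sub>E UNIV. (\<Sum>b\<in>B. c b *\<^sub>R b) \<in> V}" if "span B = V" for B
    proof -
      have "{c \<in> B \<rightarrow>\<^sub>E UNIV. (\<Sum>b\<in>B. c b *\<^sub>R b) \<in> V}
          = topspace (product_topology (\<lambda>_. euclideanreal) B)"
        unfolding that [symmetric] by (auto intro: span_sum span_scale span_base)
      then show ?thesis by (simp only: openin_topspace)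
    qed
    then show ?thesis
      by (auto simp: openin_fin_dim_topology)
  qed
  moreover have "topspace (fin_dim_topology V) \<subseteq> V"
    using openin_topspace [of "fin_dim_topology V"] unfolding openin_fin_dim_topology by blast
  ultimately show ?thesis
    by (simp add: openin_subset subset_antisym)
qed

lemma homeomorphic_map_coordinates:
  fixes B V :: "'a::real_vector set"
  assumes "finite B" "independent B" "span B = V"
  shows "homeomorphic_map (product_topology (\<lambda>_. euclideanreal) B) (fin_dim_topology V)
           (\<lambda>c. \<Sum>b\<in>B. c b *\<^sub>R b)"
proof -
  let ?P = "\<lambda>B. product_topology (\<lambda>_. euclideanreal) (B::'a set)"
  let ?\<phi> = "\<lambda>B c. \<Sum>b\<in>B. c b *\<^sub>R (b::'a)"
  have inj: "inj_on (?\<phi> B) (topspace (?P B))"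
  proof (rule inj_onI)
    fix c d assume cd: "c \<in> topspace (?P B)" "d \<in> topspace (?P B)" "?\<phi> B c = ?\<phi> B d"
    then have "(\<Sum>b\<in>B. (c b - d b) *\<^sub>R b) = 0"
      by (simp add: scaleR_left_diff_distrib sum_subtractf)
    then have "c b - d b = 0" if "b \<in> B" for b
      using independentD [OF assms(2,1) order_refl, of "\<lambda>b. c b - d b"] that by blast
    with cd show "c = d"
      by (auto simp: PiE_iff intro!: extensionalityI [of c B d])
  qed
  have surj: "?\<phi> B ` topspace (?P B) = V"
  proof
    show "?\<phi> B ` topspace (?P B) \<subseteq> V"
      using assms(3) by (auto intro: span_sum span_scale span_base)
    show "V \<subseteq> ?\<phi> B ` topspace (?P B)"
    proof
      fix v assume "v \<in> V"
      then obtain u where "v = (\<Sum>b\<in>B. u b *\<^sub>R b)"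
        using assms(1,3) by (auto simp: span_finite)
      then have "v = ?\<phi> B (restrict u B)" by simp
      moreover have "restrict u B \<in> topspace (?P B)" by simp
      ultimately show "v \<in> ?\<phi> B ` topspace (?P B)" by blast
    qed
  qed
  have open_iff: "openin (fin_dim_topology V) U \<longleftrightarrow> openin (?P B) {c \<in> topspace (?P B). ?\<phi> B c \<in> U}"
    if "U \<subseteq> V" for U
  proof
    assume "openin (fin_dim_topology V) U"
    then show "openin (?P B) {c \<in> topspace (?P B). ?\<phi> B c \<in> U}"
      using assms by (simp add: openin_fin_dim_topology)
  next
    assume op: "openin (?P B) {c \<in> topspace (?P B). ?\<phi> B c \<in> U}"
    have "openin (?P B') {c \<in> B' \<rightarrow>\<^sub>E UNIV. ?\<phi> B' c \<in> U}"
      if B': "finite B'" "independent B'" "span B' = V" for B'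
    proof -
      define h where "h c = (\<lambda>b\<in>B. \<Sum>b'\<in>B'. c b' * representation B b' b)" for c :: "'a \<Rightarrow> real"
      have rep: "(\<Sum>b\<in>B. representation B b' b *\<^sub>R b) = b'" if "b' \<in> B'" for b'
        using sum_representation_eq [OF assms(2) _ assms(1) order_refl, of b']
          that B' assms(3) span_base [of b' B'] by auto
      have h\<phi>: "?\<phi> B (h c) = ?\<phi> B' c" for c
      proof -
        have "?\<phi> B (h c) = (\<Sum>b\<in>B. \<Sum>b'\<in>B'. c b' *\<^sub>R (representation B b' b *\<^sub>R b))"
          by (simp add: h_def scaleR_sum_left)
        also have "\<dots> = (\<Sum>b'\<in>B'. c b' *\<^sub>R (\<Sum>b\<in>B. representation B b' b *\<^sub>R b))"
          by (subst sum.swap) (simp add: scaleR_sum_right)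
        finally show ?thesis by (simp add: rep)
      qed
      have "continuous_map (?P B') (?P B) h"
        unfolding continuous_map_componentwise
        by (auto simp: h_def B'(1)
            intro!: continuous_map_sum continuous_map_real_mult continuous_map_product_projection)
      then have "openin (?P B') {c \<in> topspace (?P B'). h c \<in> {c \<in> topspace (?P B). ?\<phi> B c \<in> U}}"
        using op by (rule openin_continuous_map_preimage)
      moreover have "{c \<in> topspace (?P B'). h c \<in> {c \<in> topspace (?P B). ?\<phi> B c \<in> U}}
          = {c \<in> B' \<rightarrow>\<^sub>E UNIV. ?\<phi> B' c \<in> U}"
        by (simp add: h\<phi>) (auto simp: h_def)
      ultimately show ?thesis by simp
    qed
    with that show "openin (fin_dim_topology V) U"
      by (simp add: openin_fin_dim_topology)
  qed
  show ?thesis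
    unfolding homeomorphic_map_def quotient_map_def
    using inj surj open_iff by simp
qed


section \<open>The two families of Lagrange functions\<close>

text \<open>The factors do not commute: \<open>prod_list\<close> multiplies in the order of increasing index.\<close>

definition lagrange_A :: "nat \<Rightarrow> (nat \<Rightarrow> quat) \<Rightarrow> nat \<Rightarrow> quat \<Rightarrow> quat" where
  "lagrange_A n xs j x = (\<Prod>k\<leftarrow>filter (\<lambda>k. k \<noteq> j) [0..<Suc n]. (x - xs k) * inverse (xs j - xs k))"

definition lagrange_B :: "nat \<Rightarrow> (nat \<Rightarrow> quat) \<Rightarrow> nat \<Rightarrow> quat \<Rightarrow> quat" where
  "lagrange_B n xs j x =
     (\<Prod>k\<leftarrow>filter (\<lambda>k. k \<noteq> j) [0..<Suc n]. x - xs k) *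
     inverse (\<Prod>k\<leftarrow>filter (\<lambda>k. k \<noteq> j) [0..<Suc n]. xs j - xs k)"

definition interpolant ::
    "nat \<Rightarrow> (quat \<Rightarrow> quat) set \<Rightarrow> (nat \<Rightarrow> quat) \<Rightarrow> (quat \<Rightarrow> quat) \<Rightarrow> (quat \<Rightarrow> quat)" where
  "interpolant n V xs f = (THE p. p \<in> V \<and> (\<forall>j\<le>n. p (xs j) = f (xs j)))"

end

theory Submission
  imports Defs
begin

text \<open>
  Both families satisfy \<open>\<ell>\<^sub>j(x\<^sub>i) = \<delta>\<^sub>i\<^sub>j\<close>: at \<open>x\<^sub>j\<close> the normalising factors cancel, one by one in
  the first family and all at once in the second, and at any other node one factor of the product
  vanishes.  Since the quaternions are a division ring, a product vanishes only if one of its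
  factors does, in whatever order they are multiplied, which gives the zeros
  (\<open>lagrange_eq_0_iff\<close>).  Evaluating \<open>\<Sum>\<^sub>j \<ell>\<^sub>j \<alpha>\<^sub>j\<close> at \<open>x\<^sub>i\<close> returns \<open>\<alpha>\<^sub>i\<close>, because the scalars
  stand on the right; independence, dimension, and existence and uniqueness of the interpolant are
  formal consequences (\<open>kronecker_has_rdim\<close>, \<open>kronecker_unique_interpolation\<close>).  The functions
  are polynomials because multiplying a monomial on the right by \<open>(x - a) c\<close> yields the sum of a
  monomial of the next degree and one of the same degree (\<open>QPol_mult_linear_factor\<close>).

  For the continuous dependence on the nodes, expanding \<open>\<ell>\<^sub>j\<close> into monomials is avoided.  In a
  finite-dimensional space of functions the evaluations at points separate the elements, so they
  span the dual space and every coordinate is a linear combination of finitely many evaluations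
  (\<open>dual_basis_from_evaluations\<close>).  A map into such a space is therefore continuous as soon as it
  is continuous pointwise (\<open>continuous_map_fin_dim_topology_pointwise\<close>), and for fixed \<open>x\<close> the
  value \<open>\<ell>\<^sub>j(x)\<close> is built from the nodes by products and by inverses of nonzero quaternions.  It
  remains to see that the polynomials of degree \<open>n\<close> have a finite real basis
  (\<open>QPol_finite_basis\<close>).
\<close>

section \<open>Right spans\<close>

lemma sum_apply: "(\<Sum>i\<in>I. f i) x = (\<Sum>i\<in>I. f i x)"
  by (induction I rule: infinite_finite_induct) auto

lemma rscale_apply [simp]: "rscale f \<alpha> x = f x * \<alpha>"
  by (simp add: rscale_def)

lemma
  assumes "rsubspace V"
  shows rsubspace_0: "0 \<in> V"
    and rsubspace_add: "f \<in> V \<Longrightarrow> g \<in> V \<Longrightarrow> f + g \<in> V"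
    and rsubspace_rscale: "f \<in> V \<Longrightarrow> rscale f \<alpha> \<in> V"
  using assms by (auto simp: rsubspace_def)

lemma rsubspace_sum:
  assumes "rsubspace V" "\<And>i. i \<in> I \<Longrightarrow> f i \<in> V"
  shows "(\<Sum>i\<in>I. f i) \<in> V"
  using assms by (induction I rule: infinite_finite_induct) (auto simp: rsubspace_def)

lemma rspan_base: "g \<in> S \<Longrightarrow> g \<in> rspan S"
  unfolding rspan_def
  by (rule CollectI, rule exI [of _ "{g}"], rule exI [of _ "\<lambda>_. 1"]) (auto simp: fun_eq_iff)

lemma rspan_least:
  assumes "rsubspace V" "S \<subseteq> V"
  shows "rspan S \<subseteq> V"
proof
  fix p assume "p \<in> rspan S"
  then obtain T c where "T \<subseteq> S" "p = (\<Sum>g\<in>T. rscale g (c g))"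
    unfolding rspan_def by blast
  with assms show "p \<in> V"
    by (auto intro!: rsubspace_sum rsubspace_rscale)
qed

lemma rsubspace_rspan: "rsubspace (rspan S)"
  unfolding rsubspace_def
proof (intro conjI ballI allI)
  show "0 \<in> rspan S"
    unfolding rspan_def by (rule CollectI, rule exI [of _ "{}"]) auto
next
  fix f g assume "f \<in> rspan S" "g \<in> rspan S"
  then obtain T c U d where T: "finite T" "T \<subseteq> S" "f = (\<Sum>h\<in>T. rscale h (c h))"
    and U: "finite U" "U \<subseteq> S" "g = (\<Sum>h\<in>U. rscale h (d h))"
    unfolding rspan_def by blast
  define e where "e h = (if h \<in> T then c h else 0) + (if h \<in> U then d h else 0)" for h
  have "f = (\<Sum>h\<in>T \<union> U. rscale h (if h \<in> T then c h else 0))"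
    unfolding T(3) by (rule sum.mono_neutral_cong_left) (use T U in \<open>auto simp: fun_eq_iff\<close>)
  moreover have "g = (\<Sum>h\<in>T \<union> U. rscale h (if h \<in> U then d h else 0))"
    unfolding U(3) by (rule sum.mono_neutral_cong_left) (use T U in \<open>auto simp: fun_eq_iff\<close>)
  ultimately have "f + g = (\<Sum>h\<in>T \<union> U. rscale h (e h))"
    by (simp add: fun_eq_iff sum_apply e_def distrib_left sum.distrib)
  then show "f + g \<in> rspan S"
    unfolding rspan_def using T U by (intro CollectI exI [of _ "T \<union> U"] exI [of _ e]) auto
next
  fix f \<alpha> assume "f \<in> rspan S"
  then obtain T c where T: "finite T" "T \<subseteq> S" "f = (\<Sum>h\<in>T. rscale h (c h))"
    unfolding rspan_def by blast
  then have "rscale f \<alpha> = (\<Sum>h\<in>T. rscale h (c h * \<alpha>))"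
    by (simp add: fun_eq_iff sum_apply sum_distrib_right mult.assoc)
  then show "rscale f \<alpha> \<in> rspan S"
    unfolding rspan_def using T by (intro CollectI exI [of _ T] exI [of _ "\<lambda>h. c h * \<alpha>"]) auto
qed

lemma rspan_image_finite:
  assumes "finite I" "inj_on l I"
  shows "rspan (l ` I) = range (\<lambda>a. \<Sum>i\<in>I. rscale (l i) (a i))"
proof
  show "rspan (l ` I) \<subseteq> range (\<lambda>a. \<Sum>i\<in>I. rscale (l i) (a i))"
  proof
    fix p assume "p \<in> rspan (l ` I)"
    then obtain T c where T: "T \<subseteq> l ` I" "p = (\<Sum>h\<in>T. rscale h (c h))"
      unfolding rspan_def by blast
    have "p = (\<Sum>h\<in>l ` I. rscale h (if h \<in> T then c h else 0))"
      unfolding T(2)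
      by (rule sum.mono_neutral_cong_left) (use T assms in \<open>auto simp: fun_eq_iff\<close>)
    then show "p \<in> range (\<lambda>a. \<Sum>i\<in>I. rscale (l i) (a i))"
      by (auto simp: sum.reindex assms o_def)
  qed
  have "rscale (l i) (a i) \<in> rspan (l ` I)" if "i \<in> I" for i a
    using rsubspace_rspan [of "l ` I"] rspan_base [of "l i" "l ` I"] that
    by (auto simp: rsubspace_def)
  then show "range (\<lambda>a. \<Sum>i\<in>I. rscale (l i) (a i)) \<subseteq> rspan (l ` I)"
    by (auto intro!: rsubspace_sum rsubspace_rspan)
qed

section \<open>Interpolation from the Kronecker property\<close>

context
  fixes n :: nat and l :: "nat \<Rightarrow> quat \<Rightarrow> quat" and x :: "nat \<Rightarrow> quat"
  assumes delta: "\<And>i j. i \<le> n \<Longrightarrow> j \<le> n \<Longrightarrow> l j (x i) = (if i = j then 1 else 0)"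
begin

lemma kronecker_inj_on: "inj_on l {..n}"
proof (rule inj_onI)
  fix i j assume "i \<in> {..n}" "j \<in> {..n}" "l i = l j"
  then show "i = j"
    using delta [of i i] delta [of i j] by (auto split: if_splits)
qed

lemma kronecker_eval: "i \<le> n \<Longrightarrow> (\<Sum>j\<le>n. rscale (l j) (a j)) (x i) = a i"
  by (simp add: sum_apply delta if_distrib [of "\<lambda>u. u * _"] cong: if_cong)

text \<open>
  The functions are pairwise distinct, so that their set has \<open>n + 1\<close> elements, and evaluating a
  vanishing combination at the nodes isolates its coefficients.
\<close>

lemma kronecker_has_rdim: "has_rdim (rspan (l ` {..n})) (n + 1)"
  unfolding has_rdim_def
proof (intro exI conjI)
  show "card (l ` {..n}) = n + 1"
    by (simp add: card_image kronecker_inj_on)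
  show "rindependent (l ` {..n})"
  proof -
    have "c g = 0"
      if T: "finite T" "T \<subseteq> l ` {..n}" and z: "(\<Sum>g\<in>T. rscale g (c g)) = 0" and g: "g \<in> T"
      for T c g
    proof -
      from T g obtain j where j: "j \<le> n" "g = l j"
        by auto
      have at_node: "h (x j) = (if h = g then 1 else 0)" if "h \<in> T" for h
      proof -
        from that T obtain i where "i \<le> n" "h = l i"
          by auto
        with j show ?thesis
          using inj_on_eq_iff [OF kronecker_inj_on, of i j] by (auto simp: delta)
      qed
      have "rscale h (c h) (x j) = (if h = g then c h else 0)" if "h \<in> T" for h
        unfolding rscale_apply at_node [OF that] by simp
      then have "(\<Sum>h\<in>T. rscale h (c h)) (x j) = (\<Sum>h\<in>T. if h = g then c h else 0)"
        unfolding sum_apply by (rule sum.cong [OF refl])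
      also have "\<dots> = c g"
        using T(1) g by simp
      finally show ?thesis
        by (simp only: z zero_fun_apply)
    qed
    then show ?thesis
      unfolding rindependent_def by blast
  qed
qed auto

lemma kronecker_unique_interpolation:
  "p \<in> rspan (l ` {..n}) \<and> (\<forall>j\<le>n. p (x j) = f (x j)) \<longleftrightarrow> p = (\<Sum>j\<le>n. rscale (l j) (f (x j)))"
proof
  assume p: "p \<in> rspan (l ` {..n}) \<and> (\<forall>j\<le>n. p (x j) = f (x j))"
  then obtain a where a: "p = (\<Sum>j\<le>n. rscale (l j) (a j))"
    by (auto simp: rspan_image_finite kronecker_inj_on)
  with p have "a j = f (x j)" if "j \<le> n" for j
    using kronecker_eval [OF that, of a] that by simp
  with a show "p = (\<Sum>j\<le>n. rscale (l j) (f (x j)))"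
    by simp
qed (auto simp: kronecker_eval rspan_image_finite kronecker_inj_on)

lemma kronecker_interpolant:
  "interpolant n (rspan (l ` {..n})) x f = (\<Sum>j\<le>n. rscale (l j) (f (x j)))"
  unfolding interpolant_def kronecker_unique_interpolation by simp

lemma kronecker_rlinear: "rlinear (interpolant n (rspan (l ` {..n})) x)"
  unfolding rlinear_def kronecker_interpolant
  by (simp add: fun_eq_iff sum_apply distrib_left sum.distrib sum_distrib_right mult.assoc)

end

section \<open>Products of linear factors are polynomials\<close>

lemma rsubspace_QPol: "rsubspace (QPol n)"
  unfolding QPol_def by (rule rsubspace_rspan)

lemma qmonomial_Suc: "qmonomial (Suc r) \<alpha> q = qmonomial r \<alpha> q * (q * \<alpha> (Suc r))"
  by (simp add: qmonomial_def mult.assoc)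

lemma qmonomial_cong: "(\<And>i. i \<le> r \<Longrightarrow> \<alpha> i = \<beta> i) \<Longrightarrow> qmonomial r \<alpha> = qmonomial r \<beta>"
  by (induction r) (auto simp: fun_eq_iff qmonomial_Suc, simp add: qmonomial_def)

text \<open>
  A scalar on the right is absorbed by the last coefficient.  Sums of monomials thus already
  exhaust the right span.
\<close>

lemma rscale_qmonomial: "rscale (qmonomial r \<alpha>) c = qmonomial r (\<alpha>(r := \<alpha> r * c))"
proof (cases r)
  case 0
  then show ?thesis by (simp add: fun_eq_iff qmonomial_def)
next
  case (Suc m)
  have "qmonomial m (\<alpha>(r := \<alpha> r * c)) = qmonomial m \<alpha>"
    by (rule qmonomial_cong) (simp add: Suc)
  then show ?thesis
    by (simp add: fun_eq_iff qmonomial_Suc Suc mult.assoc)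
qed

lemma qmonomial_in_QPol:
  assumes "r \<le> n"
  shows "qmonomial r \<alpha> \<in> QPol n"
proof -
  have "qmonomial r \<alpha> \<in> QHom r"
    unfolding QHom_def by (rule rspan_base) blast
  then show ?thesis
    unfolding QPol_def using assms by (intro rspan_base) blast
qed

lemma QPol_eq_rspan: "QPol n = rspan (\<Union>r\<le>n. range (qmonomial r))"
proof
  show "QPol n \<subseteq> rspan (\<Union>r\<le>n. range (qmonomial r))"
    unfolding QPol_def QHom_def
    by (intro rspan_least rsubspace_rspan UN_least) (auto intro: rspan_base)
  show "rspan (\<Union>r\<le>n. range (qmonomial r)) \<subseteq> QPol n"
    by (intro rspan_least rsubspace_QPol) (auto intro: qmonomial_in_QPol)
qed

lemma QPol_induct [consumes 1, case_names zero add monomial]: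
  assumes "p \<in> QPol n"
    and "P 0" "\<And>f g. P f \<Longrightarrow> P g \<Longrightarrow> P (f + g)" "\<And>r \<alpha>. r \<le> n \<Longrightarrow> P (qmonomial r \<alpha>)"
  shows "P p"
proof -
  from assms(1) obtain T c where T: "finite T" "T \<subseteq> (\<Union>r\<le>n. range (qmonomial r))"
      and p: "p = (\<Sum>g\<in>T. rscale g (c g))"
    unfolding QPol_eq_rspan rspan_def by blast
  have "P (rscale g (c g))" if "g \<in> T" for g
    using T(2) that assms(4) by (auto simp: rscale_qmonomial)
  with T(1) show ?thesis
    unfolding p using assms(2,3) by (induction T rule: finite_induct) auto
qed

text \<open>
  The factor is written with \<open>c\<close> on the right of \<open>x - a\<close> because the first family interleaves the
  variable with constants, which cannot be moved past it.
\<close>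

lemma QPol_mult_linear_factor:
  assumes "p \<in> QPol m"
  shows "(\<lambda>x. p x * ((x - a) * c)) \<in> QPol (Suc m)"
  using assms
proof (induction p rule: QPol_induct)
  case zero
  have "(\<lambda>x. (0 :: quat \<Rightarrow> quat) x * ((x - a) * c)) = 0"
    by (simp add: fun_eq_iff)
  then show ?case
    by (simp only: rsubspace_0 [OF rsubspace_QPol])
next
  case (add f g)
  have "(\<lambda>x. (f + g) x * ((x - a) * c)) = (\<lambda>x. f x * ((x - a) * c)) + (\<lambda>x. g x * ((x - a) * c))"
    by (simp add: fun_eq_iff distrib_right)
  with add show ?case
    by (simp only: rsubspace_add [OF rsubspace_QPol])
next
  case (monomial r \<alpha>)
  have "qmonomial r (\<alpha>(Suc r := c)) = qmonomial r \<alpha>"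
    by (rule qmonomial_cong) simp
  then have "(\<lambda>x. qmonomial r \<alpha> x * ((x - a) * c)) =
      qmonomial (Suc r) (\<alpha>(Suc r := c)) + rscale (qmonomial r \<alpha>) (- a * c)"
    by (simp add: fun_eq_iff qmonomial_Suc algebra_simps)
  with monomial show ?case
    by (simp only: rsubspace_add rsubspace_rscale rsubspace_QPol qmonomial_in_QPol
        Suc_le_mono le_SucI)
qed

lemma prod_linear_factors_in_QPol: "(\<lambda>x. \<Prod>k\<leftarrow>ks. (x - a k) * c k) \<in> QPol (length ks)"
proof (induction ks rule: rev_induct)
  case Nil
  have "qmonomial 0 (\<lambda>_. 1) = (\<lambda>x. 1)"
    by (simp add: fun_eq_iff qmonomial_def)
  then show ?case
    using qmonomial_in_QPol [of 0 0 "\<lambda>_. 1"] by simp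
next
  case (snoc k ks)
  then show ?case
    using QPol_mult_linear_factor [OF snoc, of "a k" "c k"] by simp
qed

section \<open>Finite dimension over the reals\<close>

lemma scaleR_fun_apply: "(r *\<^sub>R f) x = r *\<^sub>R f x"
  by (simp add: scaleR_fun_def)

lemma subspace_if_rsubspace:
  assumes "rsubspace V"
  shows "subspace V"
proof -
  have "scaleR r f = rscale f (of_real r)" for r and f :: "'a \<Rightarrow> quat"
    by (simp add: fun_eq_iff scaleR_fun_def scaleR_conv_of_real [symmetric] of_real_def)
  with assms show ?thesis
    by (simp add: rsubspace_def subspace_def)
qed

definition quat_units :: "quat set" where
  "quat_units = {Quat 1 0 0 0, Quat 0 1 0 0, Quat 0 0 1 0, Quat 0 0 0 1}"

lemma span_quat_units: "span quat_units = UNIV"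
proof -
  have "q \<in> span quat_units" for q
  proof -
    have "q = QRe q *\<^sub>R Quat 1 0 0 0 + QIm1 q *\<^sub>R Quat 0 1 0 0
        + QIm2 q *\<^sub>R Quat 0 0 1 0 + QIm3 q *\<^sub>R Quat 0 0 0 1"
      by (simp add: quat_eq_iff)
    also have "\<dots> \<in> span quat_units"
      by (intro span_add span_scale span_base) (auto simp: quat_units_def)
    finally show ?thesis .
  qed
  then show ?thesis by blast
qed

text \<open>
  A monomial is real-multilinear in its coefficients, so the monomials with coefficients among
  \<open>1, i, j, k\<close> span all of them over the reals.
\<close>

fun unit_monomials :: "nat \<Rightarrow> (quat \<Rightarrow> quat) set" where
  "unit_monomials 0 = (\<lambda>e q. e) ` quat_units"
| "unit_monomials (Suc r) = (\<lambda>(w, e) q. w q * (q * e)) ` (unit_monomials r \<times> quat_units)"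

lemma finite_unit_monomials: "finite (unit_monomials r)"
  by (induction r) (auto simp: quat_units_def)

lemma linear_in_span:
  assumes "linear h" "x \<in> span S" "\<And>s. s \<in> S \<Longrightarrow> h s \<in> span T"
  shows "h x \<in> span T"
proof -
  have "h ` span S = span (h ` S)"
    using linear_span_image [OF assms(1)] by simp
  also have "\<dots> \<subseteq> span T"
    using assms(3) by (intro span_minimal) auto
  finally show ?thesis
    using assms(2) by blast
qed

lemma qmonomial_in_span: "qmonomial r \<alpha> \<in> span (unit_monomials r)"
proof (induction r)
  case 0
  have "linear (\<lambda>c (q::quat). c::quat)"
    by (rule linearI) (auto simp: fun_eq_iff scaleR_fun_def)
  then have "(\<lambda>q. \<alpha> 0) \<in> span (unit_monomials 0)"
    by (rule linear_in_span [where S = quat_units])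
       (auto simp: span_quat_units intro: span_base)
  then show ?case
    by (simp add: qmonomial_def [abs_def])
next
  case (Suc r)
  have lin_c: "linear (\<lambda>c q. w q * (q * c))" for w :: "quat \<Rightarrow> quat"
    by (rule linearI) (auto simp: fun_eq_iff scaleR_fun_def distrib_left)
  have lin_w: "linear (\<lambda>w q. w q * (q * c))" for c :: quat
    by (rule linearI) (auto simp: fun_eq_iff scaleR_fun_def distrib_right)
  have "(\<lambda>q. w q * (q * c)) \<in> span (unit_monomials (Suc r))" if "w \<in> unit_monomials r" for w c
    by (rule linear_in_span [OF lin_c, where S = quat_units])
       (use that in \<open>auto simp: span_quat_units intro!: span_base\<close>)
  then have "(\<lambda>q. qmonomial r \<alpha> q * (q * \<alpha> (Suc r))) \<in> span (unit_monomials (Suc r))"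
    by (rule linear_in_span [OF lin_w Suc])
  then show ?case
    by (simp add: qmonomial_Suc [abs_def])
qed

lemma QPol_finite_basis:
  obtains B where "finite B" "independent B" "span B = QPol n"
proof -
  define W where "W = (\<Union>r\<le>n. unit_monomials r)"
  have "p \<in> span W" if "p \<in> QPol n" for p
    using that
  proof (induction p rule: QPol_induct)
    case (monomial r \<alpha>)
    then have "unit_monomials r \<subseteq> W"
      by (auto simp: W_def)
    then show ?case
      using qmonomial_in_span span_mono by blast
  qed (rule span_zero, rule span_add)
  then have W: "QPol n \<subseteq> span W"
    by blast
  obtain B where B: "B \<subseteq> QPol n" "independent B" "QPol n \<subseteq> span B"
    using maximal_independent_subset by blast
  have "finite B"
    using independent_span_bound [of W B] B W by (auto simp: W_def finite_unit_monomials)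
  moreover have "span B = QPol n"
    using B span_minimal [of B "QPol n"] subspace_if_rsubspace [OF rsubspace_QPol] by blast
  ultimately show ?thesis
    using B that by blast
qed

section \<open>Pointwise continuity suffices\<close>

text \<open>
  The coordinate functionals are combinations of evaluations \<open>f \<mapsto> f x \<bullet> e\<close>.  Of this only two
  consequences are recorded: they are linear, and they depend continuously on \<open>t\<close> along any
  pointwise continuous family \<open>F t\<close>.  The functionals are built by a Gram-Schmidt type induction:
  the residual \<open>R v\<close> of a new basis vector is not the zero function, so it is detected by an
  evaluation at some point \<open>x\<close>.  Evaluating the residuals there yields the new functional \<open>\<psi>\<close>,
  which vanishes on the old basis; subtracting multiples of \<open>\<psi>\<close> makes the old functionals vanish
  on \<open>v\<close>.
\<close>

lemma dual_basis_from_evaluations: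
  fixes B :: "('a \<Rightarrow> 'b::real_inner) set" and F :: "'t \<Rightarrow> 'a \<Rightarrow> 'b"
  assumes F: "\<And>x. continuous_map T euclidean (\<lambda>t. F t x)"
    and B: "finite B" "independent B"
  shows "\<exists>\<phi>. (\<forall>b\<in>B. linear (\<phi> b) \<and> continuous_map T euclideanreal (\<lambda>t. \<phi> b (F t)) \<and>
           (\<forall>b'\<in>B. \<phi> b b' = (if b' = b then 1 else 0)))"
  using B
proof (induction B rule: finite_induct)
  case empty
  then show ?case by simp
next
  case (insert v B)
  have ind: "independent B" and v: "v \<notin> span B"
    using insert.prems insert.hyps(2) by (auto simp: independent_insert)
  from insert.IH [OF ind] obtain \<phi> where
    lin: "\<And>b. b \<in> B \<Longrightarrow> linear (\<phi> b)" and
    cont: "\<And>b. b \<in> B \<Longrightarrow> continuous_map T euclideanreal (\<lambda>t. \<phi> b (F t))" and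
    dual: "\<And>b b'. b \<in> B \<Longrightarrow> b' \<in> B \<Longrightarrow> \<phi> b b' = (if b' = b then 1 else 0)"
    by blast
  define R where "R f = f - (\<Sum>b\<in>B. \<phi> b f *\<^sub>R b)" for f
  have "(\<Sum>b\<in>B. \<phi> b v *\<^sub>R b) \<in> span B"
    by (intro span_sum span_scale span_base)
  with v have "R v \<noteq> 0"
    by (auto simp: R_def)
  then obtain x where x: "R v x \<noteq> 0"
    by (auto simp: fun_eq_iff)
  define N where "N = R v x \<bullet> R v x"
  have N: "N \<noteq> 0"
    using x by (simp add: N_def)
  define \<psi> where "\<psi> f = (R f x \<bullet> R v x) / N" for f
  have R_apply: "R f x = f x - (\<Sum>b\<in>B. \<phi> b f *\<^sub>R b x)" for f
    by (simp add: R_def sum_apply scaleR_fun_apply)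
  have "linear R"
  proof (rule linearI)
    fix f g :: "'a \<Rightarrow> 'b" and r :: real
    show "R (f + g) = R f + R g"
      by (simp add: R_def linear_add [OF lin] scaleR_left_distrib sum.distrib)
    show "R (r *\<^sub>R f) = r *\<^sub>R R f"
      by (simp add: R_def linear_scale [OF lin] scaleR_diff_right scaleR_sum_right)
  qed
  then have \<psi>_lin: "linear \<psi>"
    by (intro linearI)
       (simp_all add: \<psi>_def linear_add linear_scale scaleR_fun_apply inner_add_left
          add_divide_distrib)
  have "R b = 0" if "b \<in> B" for b
    using that insert.hyps(1) by (simp add: R_def dual if_distrib [of "\<lambda>u. u *\<^sub>R _"] cong: if_cong)
  then have \<psi>_B: "\<psi> b = 0" if "b \<in> B" for b
    using that by (simp add: \<psi>_def)
  have \<psi>_v: "\<psi> v = 1"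
    using N by (simp add: \<psi>_def N_def)
  have \<psi>_cont: "continuous_map T euclideanreal (\<lambda>t. \<psi> (F t))"
  proof -
    have "((\<lambda>t. \<psi> (F t)) \<longlongrightarrow> \<psi> (F s)) (atin T s)" if "s \<in> topspace T" for s
      unfolding \<psi>_def R_apply
      using F [of x] cont that N
      by (intro tendsto_intros) (auto simp: continuous_map_atin)
    then show ?thesis
      by (simp add: continuous_map_atin)
  qed
  define \<phi>' where "\<phi>' b f = (if b = v then \<psi> f else \<phi> b f - \<phi> b v * \<psi> f)" for b f
  have vB: "v \<notin> B"
    by (fact insert.hyps(2))
  have "linear (\<phi>' b) \<and> continuous_map T euclideanreal (\<lambda>t. \<phi>' b (F t)) \<and>
      (\<forall>b'\<in>insert v B. \<phi>' b b' = (if b' = b then 1 else 0))" if b: "b \<in> insert v B" for b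
  proof (cases "b = v")
    case True
    then have "\<phi>' b = \<psi>"
      unfolding \<phi>'_def by simp
    with True vB show ?thesis
      by (auto simp: \<psi>_lin \<psi>_cont \<psi>_v \<psi>_B)
  next
    case False
    with b have "b \<in> B"
      by simp
    moreover have "\<phi>' b = (\<lambda>f. \<phi> b f - \<phi> b v * \<psi> f)"
      unfolding \<phi>'_def using False by simp
    moreover have "linear (\<lambda>f. \<phi> b f - \<phi> b v * \<psi> f)"
      using lin [OF \<open>b \<in> B\<close>] \<psi>_lin
      by (intro linearI) (simp_all add: linear_add linear_scale algebra_simps)
    ultimately show ?thesis
      using False vB
      by (auto simp: dual \<psi>_B \<psi>_v intro!: continuous_map_diff continuous_map_real_mult cont \<psi>_cont)
  qed
  then show ?case
    by blast
qed

text \<open>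
  With the dual basis, \<open>F\<close> is the composition of its continuous coordinates with the
  homeomorphism from coordinate space.
\<close>

lemma continuous_map_fin_dim_topology_pointwise:
  fixes B :: "('a \<Rightarrow> 'b::real_inner) set" and F :: "'t \<Rightarrow> 'a \<Rightarrow> 'b"
  assumes F: "\<And>x. continuous_map T euclidean (\<lambda>t. F t x)"
    and V: "\<And>t. t \<in> topspace T \<Longrightarrow> F t \<in> V"
    and B: "finite B" "independent B" "span B = V"
  shows "continuous_map T (fin_dim_topology V) F"
proof -
  obtain \<phi> where
    lin: "\<And>b. b \<in> B \<Longrightarrow> linear (\<phi> b)" and
    cont: "\<And>b. b \<in> B \<Longrightarrow> continuous_map T euclideanreal (\<lambda>t. \<phi> b (F t))" and
    dual: "\<And>b b'. b \<in> B \<Longrightarrow> b' \<in> B \<Longrightarrow> \<phi> b b' = (if b' = b then 1 else 0)"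
    using dual_basis_from_evaluations [of T F, OF F B(1,2)] by blast
  define \<Phi> where "\<Phi> f = (\<Sum>b\<in>B. restrict (\<lambda>b. \<phi> b f) B b *\<^sub>R b)" for f
  have expand: "\<Phi> f = f" if "f \<in> V" for f
  proof -
    from that obtain u where f: "f = (\<Sum>b\<in>B. u b *\<^sub>R b)"
      using B by (auto simp: span_finite)
    have "\<phi> b f = u b" if "b \<in> B" for b
      unfolding f using that B(1)
      by (simp add: linear_sum [OF lin] linear_scale [OF lin] dual if_distrib cong: if_cong)
    then show ?thesis
      by (simp add: \<Phi>_def f)
  qed
  have "continuous_map T (product_topology (\<lambda>_. euclideanreal) B) (\<lambda>t. restrict (\<lambda>b. \<phi> b (F t)) B)"
    by (auto simp: continuous_map_componentwise cont)
  moreover have "continuous_map (product_topology (\<lambda>_. euclideanreal) B) (fin_dim_topology V)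
      (\<lambda>c. \<Sum>b\<in>B. c b *\<^sub>R b)"
    using homeomorphic_map_coordinates [OF B] by (rule homeomorphic_imp_continuous_map)
  ultimately have "continuous_map T (fin_dim_topology V) (\<lambda>t. \<Phi> (F t))"
    unfolding \<Phi>_def by (rule continuous_map_compose [unfolded o_def])
  then show ?thesis
    by (rule continuous_map_eq) (simp add: expand V)
qed

section \<open>The Lagrange functions\<close>

lemma length_other_indices:
  assumes "j \<le> n"
  shows "length (filter (\<lambda>k. k \<noteq> j) [0..<Suc n]) = n"
proof -
  have "{i. i < Suc n \<and> [0..<Suc n] ! i \<noteq> j} = {..n} - {j}"
    by (auto simp: nth_upt simp del: upt_Suc)
  then show ?thesis
    using assms by (simp add: length_filter_conv_card del: upt_Suc)
qed

lemma lagrange_in_QPol: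
  assumes "ell = lagrange_A n \<or> ell = lagrange_B n" "j \<le> n"
  shows "ell xs j \<in> QPol n"
proof -
  let ?ks = "filter (\<lambda>k. k \<noteq> j) [0..<Suc n]"
  have *: "(\<lambda>x. \<Prod>k\<leftarrow>?ks. (x - xs k) * c k) \<in> QPol n" for c
    using prod_linear_factors_in_QPol [of xs c ?ks] length_other_indices [OF assms(2)] by simp
  from assms(1) show ?thesis
  proof
    assume "ell = lagrange_A n"
    then show ?thesis
      using * by (simp add: lagrange_A_def [abs_def])
  next
    assume B: "ell = lagrange_B n"
    have "ell xs j = rscale (\<lambda>x. \<Prod>k\<leftarrow>?ks. (x - xs k) * 1) (inverse (\<Prod>k\<leftarrow>?ks. xs j - xs k))"
      by (simp add: B fun_eq_iff lagrange_B_def del: upt_Suc)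
    also have "\<dots> \<in> QPol n"
      by (rule rsubspace_rscale [OF rsubspace_QPol *])
    finally show ?thesis .
  qed
qed

lemma lagrange_eq_0_iff:
  assumes "ell = lagrange_A n \<or> ell = lagrange_B n" "j \<le> n" "inj_on xs {..n}"
  shows "ell xs j x = 0 \<longleftrightarrow> x \<in> xs ` ({..n} - {j})"
proof -
  let ?ks = "filter (\<lambda>k. k \<noteq> j) [0..<Suc n]"
  have ks: "set ?ks = {..n} - {j}"
    by auto
  have ne: "xs j - xs k \<noteq> 0" if "k \<in> set ?ks" for k
    using that assms unfolding ks by (auto simp: inj_on_def)
  have "lagrange_A n xs j x = 0 \<longleftrightarrow> (\<exists>k\<in>set ?ks. (x - xs k) * inverse (xs j - xs k) = 0)"
    unfolding lagrange_A_def prod_list_zero_iff set_map by force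
  also have "\<dots> \<longleftrightarrow> (\<exists>k\<in>set ?ks. x = xs k)"
    using ne by (intro bex_cong) auto
  finally have A: "lagrange_A n xs j x = 0 \<longleftrightarrow> x \<in> xs ` ({..n} - {j})"
    unfolding ks by blast
  have "(\<Prod>k\<leftarrow>?ks. xs j - xs k) \<noteq> 0"
    unfolding prod_list_zero_iff set_map using ne by force
  then have "lagrange_B n xs j x = 0 \<longleftrightarrow> (\<exists>k\<in>set ?ks. x - xs k = 0)"
    unfolding lagrange_B_def mult_eq_0_iff inverse_nonzero_iff_nonzero prod_list_zero_iff set_map
    by force
  then have "lagrange_B n xs j x = 0 \<longleftrightarrow> x \<in> xs ` ({..n} - {j})"
    unfolding ks by auto
  with A assms(1) show ?thesis
    by auto
qed

lemma lagrange_at_own_node: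
  assumes "ell = lagrange_A n \<or> ell = lagrange_B n" "j \<le> n" "inj_on xs {..n}"
  shows "ell xs j (xs j) = 1"
proof -
  have ones: "(\<Prod>k\<leftarrow>ks. (xs j - xs k) * inverse (xs j - xs k)) = 1"
    if "\<forall>k\<in>set ks. xs j - xs k \<noteq> 0" for ks
    using that by (induction ks) auto
  let ?ks = "filter (\<lambda>k. k \<noteq> j) [0..<Suc n]"
  have ne: "\<forall>k\<in>set ?ks. xs j - xs k \<noteq> 0"
    using assms by (auto simp: inj_on_def simp del: upt_Suc)
  then have "lagrange_A n xs j (xs j) = 1"
    unfolding lagrange_A_def by (rule ones)
  moreover have "(\<Prod>k\<leftarrow>?ks. xs j - xs k) \<noteq> 0"
    using ne by (auto simp: prod_list_zero_iff simp del: upt_Suc)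
  then have "lagrange_B n xs j (xs j) = 1"
    unfolding lagrange_B_def by (rule right_inverse)
  ultimately show ?thesis
    using assms(1) by auto
qed

lemma lagrange_kronecker:
  assumes "ell = lagrange_A n \<or> ell = lagrange_B n" "inj_on xs {..n}" "i \<le> n" "j \<le> n"
  shows "ell xs j (xs i) = (if i = j then 1 else 0)"
  using lagrange_at_own_node [OF assms(1,4,2)] lagrange_eq_0_iff [OF assms(1,4,2)] assms(3) by auto

lemma tendsto_prod_list:
  fixes g :: "'k \<Rightarrow> 't \<Rightarrow> 'a::real_normed_algebra_1"
  assumes "\<And>k. k \<in> set ks \<Longrightarrow> (g k \<longlongrightarrow> l k) A"
  shows "((\<lambda>t. \<Prod>k\<leftarrow>ks. g k t) \<longlongrightarrow> (\<Prod>k\<leftarrow>ks. l k)) A"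
  using assms by (induction ks) (auto intro!: tendsto_mult)

text \<open>
  Distinctness of the nodes keeps the inverted quaternions away from \<open>0\<close>, where the inverse is
  discontinuous.
\<close>

lemma continuous_map_lagrange_eval:
  assumes "ell = lagrange_A n \<or> ell = lagrange_B n" "j \<le> n"
  shows "continuous_map
    (subtopology (product_topology (\<lambda>_. euclidean) {..n}) {xs. inj_on xs {..n}}) euclidean
    (\<lambda>xs. ell xs j x)"
proof -
  let ?T = "subtopology (product_topology (\<lambda>_. euclidean) {..n}) {xs::nat \<Rightarrow> quat. inj_on xs {..n}}"
  let ?ks = "filter (\<lambda>k. k \<noteq> j) [0..<Suc n]"
  have "((\<lambda>xs. ell xs j x) \<longlongrightarrow> ell ys j x) (atin ?T ys)" if ys: "ys \<in> topspace ?T" for ys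
  proof -
    have proj: "((\<lambda>xs. xs k) \<longlongrightarrow> ys k) (atin ?T ys)" if "k \<le> n" for k
    proof -
      have "continuous_map ?T euclidean (\<lambda>xs. xs k)"
        using that by (intro continuous_map_from_subtopology continuous_map_product_projection) auto
      with ys show ?thesis
        by (simp add: continuous_map_atin)
    qed
    have ne: "ys j - ys k \<noteq> 0" if "k \<in> set ?ks" for k
      using that assms ys by (auto simp: inj_on_def simp del: upt_Suc)
    have ks: "k \<le> n" if "k \<in> set ?ks" for k
      using that by (auto simp del: upt_Suc)
    have "(\<Prod>k\<leftarrow>?ks. ys j - ys k) \<noteq> 0"
      using ne by (auto simp: prod_list_zero_iff simp del: upt_Suc)
    then have "((\<lambda>xs. lagrange_B n xs j x) \<longlongrightarrow> lagrange_B n ys j x) (atin ?T ys)"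
      unfolding lagrange_B_def
      by (intro tendsto_mult tendsto_inverse tendsto_prod_list tendsto_diff tendsto_const proj ks
          assms(2))
    moreover have "((\<lambda>xs. lagrange_A n xs j x) \<longlongrightarrow> lagrange_A n ys j x) (atin ?T ys)"
      unfolding lagrange_A_def
      by (intro tendsto_mult tendsto_inverse tendsto_prod_list tendsto_diff tendsto_const proj ks
          assms(2) ne)
    ultimately show ?thesis
      using assms(1) by auto
  qed
  then show ?thesis
    by (simp add: continuous_map_atin)
qed

section \<open>The interpolation theorem\<close>

theorem mainTheorem1:
  fixes n :: nat
    and ell :: "(nat \<Rightarrow> quat) \<Rightarrow> nat \<Rightarrow> quat \<Rightarrow> quat"
  assumes "n \<ge> 1"
    and "ell = lagrange_A n \<or> ell = lagrange_B n"
  shows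
    "(\<forall>xs. inj_on xs {..n} \<longrightarrow>
        (let V = rspan (ell xs ` {..n}) in
          V \<subseteq> QPol n \<and> rsubspace V \<and> has_rdim V (n + 1) \<and>
          (\<forall>f. \<exists>!p. p \<in> V \<and> (\<forall>j\<le>n. p (xs j) = f (xs j))) \<and>
          (\<forall>f. interpolant n V xs f = (\<Sum>j\<le>n. rscale (ell xs j) (f (xs j)))) \<and>
          rlinear (interpolant n V xs)))
     \<and>
     (\<forall>xs. inj_on xs {..n} \<longrightarrow>
        (\<forall>j\<le>n. {x. ell xs j x = 0} = xs ` ({..n} - {j}) \<and> card {x. ell xs j x = 0} = n))
     \<and>
     (\<forall>j\<le>n. continuous_map
        (subtopology (product_topology (\<lambda>_. euclidean) {..n}) {xs. inj_on xs {..n}})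
        (fin_dim_topology (QPol n))
        (\<lambda>xs. ell xs j))"
proof (intro conjI allI impI)
  fix xs :: "nat \<Rightarrow> quat" assume inj: "inj_on xs {..n}"
  note delta = lagrange_kronecker [OF assms(2) inj]
  have "rspan (ell xs ` {..n}) \<subseteq> QPol n"
    using lagrange_in_QPol [OF assms(2)] by (intro rspan_least rsubspace_QPol) auto
  moreover have "\<exists>!p. p \<in> rspan (ell xs ` {..n}) \<and> (\<forall>j\<le>n. p (xs j) = f (xs j))" for f
    using kronecker_unique_interpolation [of n "ell xs" xs _ f, OF delta] by simp
  ultimately show "let V = rspan (ell xs ` {..n}) in
      V \<subseteq> QPol n \<and> rsubspace V \<and> has_rdim V (n + 1) \<and>
      (\<forall>f. \<exists>!p. p \<in> V \<and> (\<forall>j\<le>n. p (xs j) = f (xs j))) \<and>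
      (\<forall>f. interpolant n V xs f = (\<Sum>j\<le>n. rscale (ell xs j) (f (xs j)))) \<and>
      rlinear (interpolant n V xs)"
    unfolding Let_def
    using rsubspace_rspan kronecker_has_rdim [of n "ell xs" xs, OF delta]
      kronecker_interpolant [of n "ell xs" xs, OF delta]
      kronecker_rlinear [of n "ell xs" xs, OF delta] by blast
next
  fix xs :: "nat \<Rightarrow> quat" and j assume inj: "inj_on xs {..n}" and j: "j \<le> n"
  show zeros: "{x. ell xs j x = 0} = xs ` ({..n} - {j})"
    using lagrange_eq_0_iff [OF assms(2) j inj] by blast
  have "inj_on xs ({..n} - {j})"
    using inj by (rule inj_on_subset) auto
  then show "card {x. ell xs j x = 0} = n"
    using j by (simp add: zeros card_image)
next
  fix j assume j: "j \<le> n"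
  obtain B where "finite B" "independent B" "span B = QPol n"
    by (rule QPol_finite_basis)
  then show "continuous_map
      (subtopology (product_topology (\<lambda>_. euclidean) {..n}) {xs. inj_on xs {..n}})
      (fin_dim_topology (QPol n)) (\<lambda>xs. ell xs j)"
    by (intro continuous_map_fin_dim_topology_pointwise continuous_map_lagrange_eval
        lagrange_in_QPol assms(2) j)
qed

end
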